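(* For every partition $p$, the coefficient $Q_p(t)$ of the formal flow $Q(t)=\exp_\triangleleft(t\log_\triangleleft(x_{(0)}))=\sum_pQ_p(t)\frac{x_p}{p!}$ in the completed free Novikov algebra on one generator satisfies $$Q_p(t)=\sum_{k=1}^{|p|+1}n_{p,k}\binom{t}{k}.$$
   Context: Let $\mathcal A=\mathbb{Q}[x_i:i\ge-1]$ with derivation $\partial(x_i)=x_{i+1}$, product $a\triangleleft b:=\partial(a)b$ and braces $a\{a_1\cdots a_n\}=a_1\cdots a_n\partial^n(a)$. $\mathcal N(x)\subset\mathcal A$, the span of monomials of weight $-1$ (weight = sum of indices), is the free (right) Novikov algebra on $x=x_{-1}$, graded by polynomial degree. For a partition $\mu=(\mu_1\ge\cdots\ge\mu_k\ge1)$ of $n=|\mu|$, $\mu!=\prod\mu_i!$ and $x_\mu:=x_{\mu_1-1}\cdots x_{\mu_k-1}x_{-1}^{n-k+1}$; the empty partition is denoted $(0)$, with $|(0)|=0$, $(0)!=1$, $x_{(0)}:=x_{-1}$. The $x_\mu$ form a basis of $\mathcal N(x)$; infinite sums live in the completion with respect to the degree, with coefficients extended to $\mathbb{Q}[t]$. $\exp_\triangleleft(y)=\sum_{n\ge1}\frac1{n!}y^{\triangleleft n}$ with $y^{\triangleleft n}=(\cdots(y\triangleleft y)\cdots)\triangleleft y$ ($n$ factors), and $\log_\triangleleft$ is its compositional inverse. The coefficients $n_{p,k}$: $n_{p,1}=1$ if $p=(0)$ and $0$ otherwise; for $i\ge1$, $n_{p,i+1}$ is the coefficient of $\frac{x_p}{p!}$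 in the expansion of $$\sum_{k_1+\cdots+k_i=|p|,\ k_j\ge1}\frac{1}{k_1!\cdots k_i!}\big(\cdots(x\{x^{\odot k_1}\})\cdots\big)\{x^{\odot k_i}\},\qquad y\{x^{\odot k}\}=x_{-1}^k\partial^k(y).$$ *)

theory Defs
  imports
    Complex_Main
    "HOL-Library.Poly_Mapping"
    "HOL-Computational_Algebra.Polynomial"
    "HOL-Computational_Algebra.Formal_Power_Series"
begin

section \<open>The differential polynomial algebra\<close>

text \<open>
  Polynomials over \<open>'c\<close> in the variables \<open>x\<^sub>-\<^sub>1, x\<^sub>0, x\<^sub>1, \<dots>\<close>, as finitely supported
  functions from exponent vectors to coefficients.  Variables are numbered from 0, so that
  number \<open>j\<close> stands for \<open>x\<^bsub>j-1\<^esub>\<close>; in particular \<open>nvar 0\<close> is the generator \<open>x = x\<^sub>-\<^sub>1\<close>.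
\<close>

type_synonym monomial = "nat \<Rightarrow>\<^sub>0 nat"
type_synonym 'c dpoly = "monomial \<Rightarrow>\<^sub>0 'c"

definition nvar :: "nat \<Rightarrow> 'c::comm_ring_1 dpoly" where
  "nvar j = Poly_Mapping.single (Poly_Mapping.single j 1) 1"

definition scale :: "'c::comm_ring_1 \<Rightarrow> 'c dpoly \<Rightarrow> 'c dpoly" where
  "scale c a = Poly_Mapping.single 0 c * a"

definition monom_degree :: "monomial \<Rightarrow> nat" where
  "monom_degree m = (\<Sum>j\<in>Poly_Mapping.keys m. Poly_Mapping.lookup m j)"

definition monom_weight :: "monomial \<Rightarrow> int" where
  "monom_weight m = (\<Sum>j\<in>Poly_Mapping.keys m. (int j - 1) * int (Poly_Mapping.lookup m j))"

text \<open>
  The derivation with \<open>\<partial> x\<^sub>i = x\<^bsub>i+1\<^esub>\<close>, given on a monomial by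
  \<open>\<partial> m = \<Sum>\<^sub>i m\<^sub>i \<cdot> (m / x\<^sub>i) \<cdot> x\<^bsub>i+1\<^esub>\<close> and extended linearly.  The lemmas below show that
  it is indeed a linear derivation with these values on the variables.
\<close>

definition monom_deriv :: "monomial \<Rightarrow> 'c::comm_ring_1 dpoly" where
  "monom_deriv m = (\<Sum>j\<in>Poly_Mapping.keys m.
     Poly_Mapping.single (m - Poly_Mapping.single j 1 + Poly_Mapping.single (Suc j) 1)
       (of_nat (Poly_Mapping.lookup m j)))"

definition nov_deriv :: "'c::comm_ring_1 dpoly \<Rightarrow> 'c dpoly" where
  "nov_deriv a = (\<Sum>m\<in>Poly_Mapping.keys a. scale (Poly_Mapping.lookup a m) (monom_deriv m))"

lemma nov_deriv_superset:
  assumes "finite S" "Poly_Mapping.keys a \<subseteq> S"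
  shows "nov_deriv a = (\<Sum>m\<in>S. scale (Poly_Mapping.lookup a m) (monom_deriv m))"
  unfolding nov_deriv_def
  by (rule sum.mono_neutral_left) (use assms in \<open>auto simp: scale_def in_keys_iff\<close>)

lemma monom_deriv_superset:
  assumes "finite S" "Poly_Mapping.keys m \<subseteq> S"
  shows "monom_deriv m = (\<Sum>j\<in>S.
     Poly_Mapping.single (m - Poly_Mapping.single j 1 + Poly_Mapping.single (Suc j) 1)
       (of_nat (Poly_Mapping.lookup m j)))"
  unfolding monom_deriv_def
  by (rule sum.mono_neutral_left) (use assms in \<open>auto simp: in_keys_iff\<close>)

lemma nov_deriv_add: "nov_deriv (a + b) = nov_deriv a + nov_deriv b"
proof -
  let ?S = "Poly_Mapping.keys a \<union> Poly_Mapping.keys b"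
  have "Poly_Mapping.keys (a + b) \<subseteq> ?S" by (rule Poly_Mapping.keys_add)
  then show ?thesis
    by (simp add: nov_deriv_superset[of ?S] lookup_add scale_def single_add distrib_right
        sum.distrib)
qed

lemma nov_deriv_zero [simp]: "nov_deriv 0 = 0"
  by (simp add: nov_deriv_def)

lemma nov_deriv_single: "nov_deriv (Poly_Mapping.single m c) = scale c (monom_deriv m)"
  by (subst nov_deriv_superset[of "{m}"]) auto

lemma nov_deriv_sum: "nov_deriv (\<Sum>i\<in>I. f i) = (\<Sum>i\<in>I. nov_deriv (f i))"
  by (induction I rule: infinite_finite_induct) (auto simp: nov_deriv_add)

lemma nov_deriv_nvar: "nov_deriv (nvar j) = nvar (Suc j)"
  by (simp add: nvar_def nov_deriv_single scale_def monom_deriv_def mult_single)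

lemma monom_deriv_add:
  "monom_deriv (m + n) =
     monom_deriv m * Poly_Mapping.single n (1 :: 'c::comm_ring_1)
       + Poly_Mapping.single m 1 * monom_deriv n"
proof -
  let ?S = "Poly_Mapping.keys m \<union> Poly_Mapping.keys n"
  let ?e = "\<lambda>j. Poly_Mapping.single j (1 :: nat)"
  let ?t = "\<lambda>u j. Poly_Mapping.single (u - ?e j + ?e (Suc j))"
  have pull: "m' + n' - ?e j = (m' - ?e j) + n'" if "Poly_Mapping.lookup m' j \<noteq> 0"
    for m' n' :: monomial and j
    by (rule poly_mapping_eqI) (use that in \<open>auto simp: lookup_add lookup_minus lookup_single when_def\<close>)
  have shift1: "?t m j c * Poly_Mapping.single n 1 = ?t (m + n) j c"
    if "c = of_nat (Poly_Mapping.lookup m j)" for j and c :: 'c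
    using pull[of m j n] that
    by (cases "Poly_Mapping.lookup m j = 0") (simp_all add: mult_single ac_simps)
  have shift2: "Poly_Mapping.single m 1 * ?t n j c = ?t (m + n) j c"
    if "c = of_nat (Poly_Mapping.lookup n j)" for j and c :: 'c
    using pull[of n j m] that
    by (cases "Poly_Mapping.lookup n j = 0") (simp_all add: mult_single ac_simps)
  have term_eq: "?t (m + n) j (of_nat (Poly_Mapping.lookup (m + n) j) :: 'c) =
      ?t m j (of_nat (Poly_Mapping.lookup m j)) * Poly_Mapping.single n 1
      + Poly_Mapping.single m 1 * ?t n j (of_nat (Poly_Mapping.lookup n j))" for j
    by (simp only: shift1 shift2 lookup_add of_nat_add single_add)
  have "Poly_Mapping.keys (m + n) \<subseteq> ?S" by (rule Poly_Mapping.keys_add)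
  then have "monom_deriv (m + n) =
      (\<Sum>j\<in>?S. ?t (m + n) j (of_nat (Poly_Mapping.lookup (m + n) j) :: 'c))"
    by (intro monom_deriv_superset) auto
  also have "\<dots> = (\<Sum>j\<in>?S. ?t m j (of_nat (Poly_Mapping.lookup m j))) * Poly_Mapping.single n 1
      + Poly_Mapping.single m 1 * (\<Sum>j\<in>?S. ?t n j (of_nat (Poly_Mapping.lookup n j)))"
    by (simp only: term_eq sum.distrib sum_distrib_left sum_distrib_right)
  also have "(\<Sum>j\<in>?S. ?t m j (of_nat (Poly_Mapping.lookup m j) :: 'c)) = monom_deriv m"
    by (rule monom_deriv_superset[symmetric]) auto
  also have "(\<Sum>j\<in>?S. ?t n j (of_nat (Poly_Mapping.lookup n j) :: 'c)) = monom_deriv n"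
    by (rule monom_deriv_superset[symmetric]) auto
  finally show ?thesis .
qed

lemma dpoly_as_sum:
  "(a :: 'c::comm_ring_1 dpoly) =
     (\<Sum>m\<in>Poly_Mapping.keys a. Poly_Mapping.single m (Poly_Mapping.lookup a m))"
  by (rule poly_mapping_eqI) (auto simp: lookup_sum lookup_single when_def in_keys_iff)

lemma nov_deriv_mult: "nov_deriv (a * b) = nov_deriv a * b + a * nov_deriv b"
proof -
  have single: "nov_deriv (Poly_Mapping.single m c * Poly_Mapping.single n d) =
      nov_deriv (Poly_Mapping.single m c) * Poly_Mapping.single n d
      + Poly_Mapping.single m c * nov_deriv (Poly_Mapping.single n d)"
    for m n and c d :: 'a
  proof -
    have s: "Poly_Mapping.single k e = Poly_Mapping.single 0 e * Poly_Mapping.single k (1 :: 'a)"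
      for k :: monomial and e by (simp add: mult_single)
    have cd: "Poly_Mapping.single (0 :: monomial) (c * d) =
        Poly_Mapping.single 0 c * Poly_Mapping.single 0 d" by (simp add: mult_single)
    show ?thesis
      unfolding mult_single nov_deriv_single monom_deriv_add scale_def
      by (subst s[of m c], subst s[of n d], simp only: cd) (simp add: algebra_simps)
  qed
  let ?f = "\<lambda>a m. Poly_Mapping.single m (Poly_Mapping.lookup (a :: 'a dpoly) m)"
  let ?A = "Poly_Mapping.keys a" and ?B = "Poly_Mapping.keys b"
  have "nov_deriv ((\<Sum>m\<in>?A. ?f a m) * (\<Sum>n\<in>?B. ?f b n)) =
      nov_deriv (\<Sum>m\<in>?A. ?f a m) * (\<Sum>n\<in>?B. ?f b n)
      + (\<Sum>m\<in>?A. ?f a m) * nov_deriv (\<Sum>n\<in>?B. ?f b n)"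
    by (simp only: sum_product nov_deriv_sum single sum.distrib)
  then show ?thesis
    by (simp only: dpoly_as_sum[symmetric])
qed

definition brace :: "'c::comm_ring_1 dpoly \<Rightarrow> 'c dpoly list \<Rightarrow> 'c dpoly" where
  "brace a bs = prod_list bs * (nov_deriv ^^ length bs) a"


section \<open>Partitions and the coefficients \<open>n\<^bsub>p,k\<^esub>\<close>\<close>

text \<open>A partition is the list of its parts; \<open>[]\<close> is the partition written \<open>(0)\<close>.\<close>

definition is_partition :: "nat list \<Rightarrow> bool" where
  "is_partition \<mu> \<longleftrightarrow> sorted_wrt (\<ge>) \<mu> \<and> (\<forall>m\<in>set \<mu>. 1 \<le> m)"

definition part_fact :: "nat list \<Rightarrow> nat" where
  "part_fact \<mu> = (\<Prod>m\<leftarrow>\<mu>. fact m)"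

text \<open>
  The exponent vector of \<open>x\<^sub>\<mu>\<close>.  A part \<open>m\<close> contributes \<open>x\<^bsub>m-1\<^esub>\<close>, which is variable number
  \<open>m\<close>; the subtraction does not truncate, since a partition has at most \<open>|\<mu>|\<close> parts.
\<close>

definition part_exponent :: "nat list \<Rightarrow> monomial" where
  "part_exponent \<mu> = (\<Sum>m\<leftarrow>\<mu>. Poly_Mapping.single m 1)
     + Poly_Mapping.single 0 (sum_list \<mu> - length \<mu> + 1)"

text \<open>The coefficient of \<open>x\<^sub>\<mu> / \<mu>!\<close>, where \<open>x\<^sub>\<mu>\<close> is a monomial.\<close>

definition part_coeff :: "nat list \<Rightarrow> 'c::comm_ring_1 dpoly \<Rightarrow> 'c" where
  "part_coeff \<mu> a = of_nat (part_fact \<mu>) * Poly_Mapping.lookup a (part_exponent \<mu>)"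

definition compositions :: "nat \<Rightarrow> nat \<Rightarrow> nat list set" where
  "compositions i n = {ks. length ks = i \<and> (\<forall>k\<in>set ks. 1 \<le> k) \<and> sum_list ks = n}"

text \<open>\<open>(\<dots>(x{x\<^bsup>k\<^sub>1\<^esup>})\<dots>){x\<^bsup>k\<^sub>i\<^esup>}\<close> for \<open>ks = [k\<^sub>1, \<dots>, k\<^sub>i]\<close>\<close>

definition nested_brace :: "nat list \<Rightarrow> rat dpoly" where
  "nested_brace ks = foldl (\<lambda>y k. brace y (replicate k (nvar 0))) (nvar 0) ks"

text \<open>Only \<open>k \<ge> 1\<close> is meaningful; \<open>k = 0\<close> is given the value 0.\<close>

fun n_coeff :: "nat list \<Rightarrow> nat \<Rightarrow> rat" where
  "n_coeff p 0 = 0"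
| "n_coeff p (Suc 0) = (if p = [] then 1 else 0)"
| "n_coeff p (Suc (Suc j)) = part_coeff p
     (\<Sum>ks\<in>compositions (Suc j) (sum_list p).
        scale (1 / (\<Prod>k\<leftarrow>ks. fact k)) (nested_brace ks))"


section \<open>The completed free Novikov algebra over \<open>\<rat>[t]\<close>\<close>

text \<open>
  An element of the completion is a sequence whose \<open>d\<close>-th member lies in the component of
  \<open>\<N>(x) \<otimes> \<rat>[t]\<close> of polynomial degree \<open>d\<close>.  Such sequences are stored as formal power
  series, whose variable only records the degree: their topology is that of the
  completion, and their Cauchy product is the product of the completion of \<open>\<A> \<otimes> \<rat>[t]\<close>.
\<close>

type_synonym nov = "rat poly dpoly fps"

definition nov_carrier :: "nov set" where
  "nov_carrier = {F. \<forall>d. \<forall>m\<in>Poly_Mapping.keys (fps_nth F d).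
                        monom_degree m = d \<and> monom_weight m = -1}"

definition nov_gen :: nov where
  "nov_gen = Abs_fps (\<lambda>d. if d = 1 then nvar 0 else 0)"

definition nov_scale :: "rat poly \<Rightarrow> nov \<Rightarrow> nov" where
  "nov_scale c F = Abs_fps (\<lambda>d. scale c (fps_nth F d))"

definition nov_prod :: "nov \<Rightarrow> nov \<Rightarrow> nov"  (infixl \<open>\<triangleleft>\<close> 70) where
  "F \<triangleleft> G = Abs_fps (\<lambda>d. nov_deriv (fps_nth F d)) * G"

text \<open>\<open>nov_power F n\<close> is the left-bracketed product of \<open>n + 1\<close> factors \<open>F\<close>.\<close>

primrec nov_power :: "nov \<Rightarrow> nat \<Rightarrow> nov" where
  "nov_power F 0 = F"
| "nov_power F (Suc n) = nov_power F n \<triangleleft> F"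

definition nov_exp :: "nov \<Rightarrow> nov" where
  "nov_exp F = suminf (\<lambda>n. nov_scale [:1 / fact (Suc n):] (nov_power F n))"

text \<open>
  On the completed algebra \<open>nov_exp F\<close> is \<open>F\<close> plus terms of higher degree, so it is a bijection
  there; its inverse is the logarithm.
\<close>

definition nov_log :: "nov \<Rightarrow> nov" where
  "nov_log = inv_into nov_carrier nov_exp"

definition nov_flow :: nov where
  "nov_flow = nov_exp (nov_scale [:0, 1:] (nov_log nov_gen))"

text \<open>\<open>x\<^sub>p\<close> has degree \<open>|p| + 1\<close>, so \<open>Q\<^sub>p(t)\<close> is read off in that component.\<close>

definition Q_coeff :: "nat list \<Rightarrow> rat poly" where
  "Q_coeff p = part_coeff p (fps_nth nov_flow (sum_list p + 1))"

text \<open>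
  The binomial coefficient \<open>t (t - 1) \<dots> (t - k + 1) / k!\<close> as an element of \<open>\<rat>[t]\<close>; the
  library's \<open>gchoose\<close> is constrained to fields.
\<close>

definition binom_poly :: "nat \<Rightarrow> rat poly" where
  "binom_poly k = smult (1 / fact k) (\<Prod>i<k. [:- of_nat i, 1:])"

lemma poly_binom_poly: "poly (binom_poly k) a = a gchoose k"
  by (simp add: binom_poly_def poly_prod gbinomial_prod_rev atLeast0LessThan)

end

theory Submission
  imports Defs
begin

text \<open>
  Let \<open>x\<close> be the generator, \<open>L = log x\<close> and \<open>D = L \<partial>\<close>.  Since the left-bracketed powers of \<open>tL\<close>
  are \<open>t\<^sup>n D\<^bsup>n-1\<^esup> L\<close>, the flow is \<open>Q(t) = ((e\<^bsup>tD\<^esup> - 1) / D) L\<close>.  Expanding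
  \<open>e\<^bsup>tD\<^esup> = \<Sum>\<^sub>k (t choose k) (e\<^sup>D - 1)\<^sup>k\<close> and using \<open>((e\<^sup>D - 1) / D) L = exp L = x\<close> gives
  \<open>Q(t) = \<Sum>\<^bsub>k\<ge>1\<^esub> (t choose k) (e\<^sup>D - 1)\<^bsup>k-1\<^esup> x\<close>.  Finally \<open>e\<^sup>D\<close> is the time-one flow of the vector
  field \<open>L \<partial>\<close>, whose displacement is \<open>exp L = x\<close>, so Taylor's formula reads
  \<open>(e\<^sup>D - 1) a = \<Sum>\<^bsub>j\<ge>1\<^esub> x\<^sup>j \<partial>\<^sup>j a / j!\<close>, and its iterates on \<open>x\<close> are the sums of nested braces that
  define \<open>n\<^bsub>p,k\<^esub>\<close>.
\<close>

section \<open>Formal sums of power series\<close>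

definition vanishes_below :: "nat \<Rightarrow> 'a::zero fps \<Rightarrow> bool" where
  "vanishes_below d F \<longleftrightarrow> (\<forall>i<d. fps_nth F i = 0)"

lemma vanishes_below_0 [simp]: "vanishes_below 0 F"
  by (simp add: vanishes_below_def)

lemma vanishes_below_mono: "vanishes_below d F \<Longrightarrow> e \<le> d \<Longrightarrow> vanishes_below e F"
  by (simp add: vanishes_below_def)

lemma vanishes_below_nth: "vanishes_below d F \<Longrightarrow> i < d \<Longrightarrow> fps_nth F i = 0"
  by (simp add: vanishes_below_def)

lemma vanishes_below_mult:
  fixes F G :: "'a::semiring_0 fps"
  assumes "vanishes_below d F" "vanishes_below e G"
  shows "vanishes_below (d + e) (F * G)"
  unfolding vanishes_below_def
proof safe
  fix i assume i: "i < d + e"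
  show "fps_nth (F * G) i = 0" unfolding fps_mult_nth
  proof (rule sum.neutral, rule)
    fix j assume "j \<in> {0..i}"
    then have "j < d \<or> i - j < e" using i by auto
    then show "fps_nth F j * fps_nth G (i - j) = 0"
      using assms by (auto simp: vanishes_below_def)
  qed
qed

lemma vanishes_below_mult_left:
  fixes F G :: "'a::semiring_0 fps"
  shows "vanishes_below d G \<Longrightarrow> vanishes_below d (F * G)"
  using vanishes_below_mult[of 0 F d G] by simp

lemma vanishes_below_sum:
  fixes f :: "'i \<Rightarrow> 'a::comm_monoid_add fps"
  shows "(\<And>i. i \<in> I \<Longrightarrow> vanishes_below d (f i)) \<Longrightarrow> vanishes_below d (sum f I)"
  by (simp add: vanishes_below_def fps_sum_nth)

text \<open>This is the sum of the series only for families that are \<open>vanishing\<close> in the sense below.\<close>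

definition fps_total :: "(nat \<Rightarrow> 'a::comm_monoid_add fps) \<Rightarrow> 'a fps" where
  "fps_total f = Abs_fps (\<lambda>d. \<Sum>n\<le>d. fps_nth (f n) d)"

definition vanishing :: "(nat \<Rightarrow> 'a::zero fps) \<Rightarrow> bool" where
  "vanishing f \<longleftrightarrow> (\<forall>n. vanishes_below n (f n))"

lemma vanishing_nth: "vanishing f \<Longrightarrow> i < n \<Longrightarrow> fps_nth (f n) i = 0"
  by (simp add: vanishing_def vanishes_below_def)

lemma fps_total_nth:
  assumes "vanishing f" "d \<le> N"
  shows "fps_nth (fps_total f) d = (\<Sum>n\<le>N. fps_nth (f n) d)"
  unfolding fps_total_def fps_nth_Abs_fps
  by (rule sum.mono_neutral_left) (use assms in \<open>auto intro: vanishing_nth\<close>)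

lemma suminf_eq_fps_total:
  fixes f :: "nat \<Rightarrow> 'a::comm_ring_1 fps"
  assumes "vanishing f"
  shows "suminf f = fps_total f"
proof (rule sums_unique[symmetric], unfold sums_def, rule tendsto_fpsI)
  fix d
  show "\<forall>\<^sub>F n in sequentially. fps_nth (sum f {..<n}) d = fps_nth (fps_total f) d"
  proof (rule eventually_sequentiallyI)
    fix n assume "Suc d \<le> n"
    then show "fps_nth (sum f {..<n}) d = fps_nth (fps_total f) d"
      using fps_total_nth[OF assms, of d "n - 1"]
      by (cases n) (simp_all add: fps_sum_nth lessThan_Suc_atMost)
  qed
qed

lemma fps_total_split:
  fixes f :: "nat \<Rightarrow> 'a::comm_ring_1 fps"
  assumes "vanishing f"
  obtains r where "vanishes_below (Suc N) r" "fps_total f = (\<Sum>n\<le>N. f n) + r"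
proof
  show "vanishes_below (Suc N) (fps_total f - (\<Sum>n\<le>N. f n))"
    unfolding vanishes_below_def
    by (auto simp: fps_sum_nth fps_total_nth[OF assms, of _ N])
qed simp

lemma fps_total_additive_nth:
  fixes f :: "nat \<Rightarrow> 'a::comm_ring_1 fps" and \<phi> :: "'a fps \<Rightarrow> 'a fps"
  assumes f: "vanishing f"
    and add: "\<And>a b. \<phi> (a + b) = \<phi> a + \<phi> b"
    and low: "\<And>d a. vanishes_below d a \<Longrightarrow> vanishes_below d (\<phi> a)"
    and "d \<le> N"
  shows "fps_nth (\<phi> (fps_total f)) d = (\<Sum>n\<le>N. fps_nth (\<phi> (f n)) d)"
proof -
  obtain r where r: "vanishes_below (Suc N) r" "fps_total f = (\<Sum>n\<le>N. f n) + r"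
    using fps_total_split[OF f] .
  have 0: "\<phi> 0 = 0" using add[of 0 0] by simp
  have sum: "\<phi> (\<Sum>n\<in>I. f n) = (\<Sum>n\<in>I. \<phi> (f n))" for I :: "nat set"
    by (induction I rule: infinite_finite_induct) (simp_all add: 0 add)
  have "fps_nth (\<phi> r) d = 0"
    using low[OF r(1)] \<open>d \<le> N\<close> by (simp add: vanishes_below_def)
  then show ?thesis
    by (simp add: r(2) add sum fps_sum_nth)
qed

lemma fps_total_mult_left_nth:
  fixes f :: "nat \<Rightarrow> 'a::comm_ring_1 fps"
  assumes "vanishing f" "d \<le> N"
  shows "fps_nth (c * fps_total f) d = (\<Sum>n\<le>N. fps_nth (c * f n) d)"
  by (rule fps_total_additive_nth[OF assms(1), where \<phi> = "(*) c"])
    (simp_all add: assms distrib_left vanishes_below_mult_left)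

lemma triangle_sum_nat:
  fixes h :: "nat \<Rightarrow> nat \<Rightarrow> 'a::comm_monoid_add"
  assumes "\<And>i j. i + j > d \<Longrightarrow> h i j = 0"
  shows "(\<Sum>n\<le>d. \<Sum>i\<le>n. h i (n - i)) = (\<Sum>i\<le>d. \<Sum>j\<le>d. h i j)"
proof -
  have "(\<Sum>n\<le>d. \<Sum>i\<le>n. h i (n - i)) = (\<Sum>(i, j)\<in>{(i, j). i + j \<le> d}. h i j)"
    by (simp add: sum.triangle_reindex_eq[of h, symmetric])
  also have "\<dots> = (\<Sum>(i, j)\<in>{..d} \<times> {..d}. h i j)"
    by (rule sum.mono_neutral_left) (auto intro: assms)
  finally show ?thesis by (simp add: sum.cartesian_product)
qed

lemma fps_total_mult:
  fixes F G :: "'a::comm_ring_1 fps fps"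
  assumes F: "vanishing (fps_nth F)" and G: "vanishing (fps_nth G)"
  shows "fps_total (fps_nth (F * G)) = fps_total (fps_nth F) * fps_total (fps_nth G)"
proof (rule fps_ext)
  fix d
  let ?h = "\<lambda>i j. fps_nth (fps_nth F i * fps_nth G j) d"
  have h0: "?h i j = 0" if "i + j > d" for i j
    using vanishes_below_mult[of i "fps_nth F i" j "fps_nth G j"] F G that
    by (auto simp: vanishing_def vanishes_below_def)
  have "fps_nth (fps_total (fps_nth F) * fps_total (fps_nth G)) d
      = (\<Sum>j\<le>d. fps_nth (fps_total (fps_nth F) * fps_nth G j) d)"
    by (rule fps_total_mult_left_nth[OF G]) simp
  also have "\<dots> = (\<Sum>j\<le>d. \<Sum>i\<le>d. ?h i j)"
    using fps_total_mult_left_nth[OF F, of d d] by (simp add: mult.commute)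
  also have "\<dots> = (\<Sum>n\<le>d. \<Sum>i\<le>n. ?h i (n - i))"
    by (subst triangle_sum_nat) (use h0 in \<open>auto intro: sum.swap\<close>)
  also have "\<dots> = fps_nth (fps_total (fps_nth (F * G))) d"
    by (simp add: fps_total_def fps_mult_nth fps_sum_nth atLeast0AtMost)
  finally show "fps_nth (fps_total (fps_nth (F * G))) d
    = fps_nth (fps_total (fps_nth F) * fps_total (fps_nth G)) d" by simp
qed

lemma vanishing_mult:
  fixes F G :: "'a::comm_ring_1 fps fps"
  assumes "vanishing (fps_nth F)" "vanishing (fps_nth G)"
  shows "vanishing (fps_nth (F * G))"
  unfolding vanishing_def fps_mult_nth
proof (intro allI vanishes_below_sum)
  fix n i :: nat assume "i \<in> {0..n}"
  then show "vanishes_below n (fps_nth F i * fps_nth G (n - i))"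
    using vanishes_below_mult[of i "fps_nth F i" "n - i" "fps_nth G (n - i)"] assms
    by (simp add: vanishing_def)
qed

lemma vanishing_one: "vanishing (fps_nth (1 :: 'a::comm_ring_1 fps fps))"
  by (simp add: vanishing_def vanishes_below_def)

lemma vanishing_power:
  fixes F :: "'a::comm_ring_1 fps fps"
  shows "vanishing (fps_nth F) \<Longrightarrow> vanishing (fps_nth (F ^ k))"
  by (induction k) (simp_all add: vanishing_one vanishing_mult)

lemma fps_total_power:
  fixes F :: "'a::comm_ring_1 fps fps"
  assumes "vanishing (fps_nth F)"
  shows "fps_total (fps_nth (F ^ k)) = fps_total (fps_nth F) ^ k"
proof (induction k)
  case 0
  show ?case
  proof (rule fps_ext)
    fix d
    have "fps_nth (fps_total (fps_nth (1 :: 'a fps fps))) d = (\<Sum>n\<le>d. if n = 0 then fps_nth 1 d else 0)"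
      by (simp only: fps_total_def fps_nth_Abs_fps) (rule sum.cong, auto)
    then show "fps_nth (fps_total (fps_nth (F ^ 0))) d = fps_nth (fps_total (fps_nth F) ^ 0) d"
      by simp
  qed
next
  case (Suc k)
  then show ?case
    by (simp add: fps_total_mult[OF assms vanishing_power[OF assms]])
qed

section \<open>The derivation of the completed algebra\<close>

definition fps_nov_deriv :: "'c::comm_ring_1 dpoly fps \<Rightarrow> 'c dpoly fps" (\<open>\<delta>\<close>) where
  "\<delta> F = Abs_fps (\<lambda>d. nov_deriv (fps_nth F d))"

abbreviation const :: "'c::comm_ring_1 \<Rightarrow> 'c dpoly fps" where
  "const c \<equiv> fps_const (Poly_Mapping.single 0 c)"

lemma nov_prod_eq: "F \<triangleleft> G = \<delta> F * G"
  by (simp add: nov_prod_def fps_nov_deriv_def)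

lemma nov_scale_eq: "nov_scale c F = const c * F"
  by (rule fps_ext) (simp add: nov_scale_def scale_def)

lemma const_mult: "const (c * d) = const c * const d"
  by (simp add: mult_single)

lemma const_add: "const (c + d) = const c + const d"
  by (simp add: single_add)

lemma const_sum: "const (sum f I) = (\<Sum>i\<in>I. const (f i))"
  by (induction I rule: infinite_finite_induct) (simp_all add: const_add del: fps_const_add)

lemma const_of_nat: "const (of_nat n :: 'c::comm_ring_1) = of_nat n"
  by (induction n) (simp_all add: const_add del: fps_const_add)

lemma nov_deriv_const [simp]: "nov_deriv (Poly_Mapping.single 0 c) = 0"
  by (simp add: nov_deriv_single monom_deriv_def scale_def)

lemma nov_deriv_scale: "nov_deriv (scale c a) = scale c (nov_deriv a)"
  by (simp add: scale_def nov_deriv_mult)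

lemma fps_nov_deriv_nth [simp]: "fps_nth (\<delta> F) d = nov_deriv (fps_nth F d)"
  by (simp add: fps_nov_deriv_def)

lemma fps_nov_deriv_add: "\<delta> (F + G) = \<delta> F + \<delta> G"
  by (rule fps_ext) (simp add: nov_deriv_add)

lemma fps_nov_deriv_mult: "\<delta> (F * G) = \<delta> F * G + F * \<delta> G"
  by (rule fps_ext) (simp add: fps_mult_nth nov_deriv_sum nov_deriv_mult sum.distrib)

lemma fps_nov_deriv_const [simp]: "\<delta> (const c) = 0"
  by (rule fps_ext) simp

lemma fps_nov_deriv_const_mult: "\<delta> (const c * F) = const c * \<delta> F"
  by (simp add: fps_nov_deriv_mult)

lemma vanishes_below_fps_nov_deriv: "vanishes_below d F \<Longrightarrow> vanishes_below d (\<delta> F)"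
  by (simp add: vanishes_below_def)


section \<open>Power series in the operator \<open>L \<partial>\<close>\<close>

abbreviation rconst :: "rat \<Rightarrow> nov" where
  "rconst r \<equiv> const [:r:]"

lemma rconst_add: "rconst (a + b) = rconst a + rconst b"
  using const_add[of "[:a:]" "[:b:]"] by (simp del: fps_const_add)

lemma rconst_mult: "rconst (a * b) = rconst a * rconst b"
  using const_mult[of "[:a:]" "[:b:]"] by (simp add: mult.commute del: fps_const_mult)

lemma rconst_of_nat: "rconst (of_nat n) = of_nat n"
  using const_of_nat[of n, where 'c = "rat poly"] by (simp add: of_nat_poly)

lemma rconst_sum: "rconst (sum f I) = (\<Sum>i\<in>I. rconst (f i))"
  by (induction I rule: infinite_finite_induct) (simp_all add: rconst_add del: fps_const_add)

lemma rconst_cancel: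
  fixes F G :: nov
  assumes "of_nat (Suc n) * F = of_nat (Suc n) * G"
  shows "F = G"
proof -
  have 1: "rconst (1 / of_nat (Suc n)) * of_nat (Suc n) = 1"
    unfolding rconst_of_nat[symmetric] rconst_mult[symmetric] by (simp add: one_pCons[symmetric])
  have "rconst (1 / of_nat (Suc n)) * of_nat (Suc n) * F = rconst (1 / of_nat (Suc n)) * of_nat (Suc n) * G"
    using assms by (simp add: mult.assoc del: of_nat_Suc)
  then show ?thesis by (simp only: 1 mult_1)
qed

locale vector_field =
  fixes L :: nov
  assumes L0: "fps_nth L 0 = 0"
begin

lemma vanishes_L: "vanishes_below 1 L"
  by (simp add: vanishes_below_def L0)

definition D :: "nov \<Rightarrow> nov" where
  "D a = L * \<delta> a"

lemma D_add: "D (a + b) = D a + D b"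
  by (simp add: D_def fps_nov_deriv_add distrib_left)

lemma D_mult: "D (a * b) = D a * b + a * D b"
  by (simp add: D_def fps_nov_deriv_mult algebra_simps)

lemma D_const_mult: "D (const c * a) = const c * D a"
  by (simp add: D_def fps_nov_deriv_const_mult mult.left_commute)

lemma D_0 [simp]: "D 0 = 0"
  using D_const_mult[of 0 0] by simp

lemma D_sum: "D (sum f I) = (\<Sum>i\<in>I. D (f i))"
  by (induction I rule: infinite_finite_induct) (simp_all add: D_add)

lemma vanishes_below_D: "vanishes_below d a \<Longrightarrow> vanishes_below (Suc d) (D a)"
  using vanishes_below_mult[OF vanishes_L vanishes_below_fps_nov_deriv[of d a]] by (simp add: D_def)

lemma D_pow_add: "(D ^^ n) (a + b) = (D ^^ n) a + (D ^^ n) b"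
  by (induction n) (simp_all add: D_add)

lemma D_pow_const_mult: "(D ^^ n) (const c * a) = const c * (D ^^ n) a"
  by (induction n) (simp_all add: D_const_mult)

lemma vanishes_below_D_pow: "vanishes_below d a \<Longrightarrow> vanishes_below (d + n) ((D ^^ n) a)"
  by (induction n) (simp_all add: vanishes_below_D)

lemma vanishing_op: "vanishing (\<lambda>n. const (c n) * (D ^^ n) a)"
  using vanishes_below_D_pow[of 0 a] by (simp add: vanishing_def vanishes_below_mult_left)

definition op :: "rat fps \<Rightarrow> nov \<Rightarrow> nov" where
  "op f a = fps_total (\<lambda>n. rconst (fps_nth f n) * (D ^^ n) a)"

lemma op_nth: "d \<le> N \<Longrightarrow> fps_nth (op f a) d = (\<Sum>n\<le>N. fps_nth (rconst (fps_nth f n) * (D ^^ n) a) d)"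
  unfolding op_def by (rule fps_total_nth[OF vanishing_op])

lemma op_diff: "op (f - g) a = op f a - op g a"
proof (rule fps_ext)
  fix d
  have r: "rconst (x - y) = rconst x - rconst y" for x y
    using rconst_add[of "x - y" y] by (simp del: fps_const_add fps_const_sub)
  show "fps_nth (op (f - g) a) d = fps_nth (op f a - op g a) d"
    by (simp only: op_nth[OF order_refl] fps_sub_nth r left_diff_distrib sum_subtractf)
qed

lemma op_one [simp]: "op 1 a = a"
proof (rule fps_ext)
  fix d
  have "fps_nth (op 1 a) d = (\<Sum>n\<le>d. if n = 0 then fps_nth a d else 0)"
    unfolding op_nth[OF order_refl]
    by (rule sum.cong) (auto simp: one_pCons[symmetric])
  then show "fps_nth (op 1 a) d = fps_nth a d" by simp
qed

lemma op_mult: "op (f * g) a = op f (op g a)"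
proof (rule fps_ext)
  fix d
  let ?h = "\<lambda>i j. fps_nth (rconst (fps_nth f i) * (D ^^ i) (rconst (fps_nth g j) * (D ^^ j) a)) d"
  have h: "?h i j = fps_nth (rconst (fps_nth f i * fps_nth g j) * (D ^^ (i + j)) a) d" for i j
    by (simp add: D_pow_const_mult funpow_add rconst_mult mult.assoc del: fps_const_mult)
  have h0: "?h i j = 0" if "i + j > d" for i j
    unfolding h using that
    by (intro vanishes_below_nth[OF vanishes_below_mult_left[OF
          vanishes_below_D_pow[OF vanishes_below_0]]]) auto
  have in_eq: "fps_nth (rconst (fps_nth f i) * (D ^^ i) (op g a)) d = (\<Sum>j\<le>d. ?h i j)" for i
    unfolding op_def[of g]
  proof (rule fps_total_additive_nth[OF vanishing_op])
    fix b c show "rconst (fps_nth f i) * (D ^^ i) (b + c)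
        = rconst (fps_nth f i) * (D ^^ i) b + rconst (fps_nth f i) * (D ^^ i) c"
      by (simp add: D_pow_add distrib_left)
  next
    fix e b assume "vanishes_below e (b :: nov)"
    then show "vanishes_below e (rconst (fps_nth f i) * (D ^^ i) b)"
      by (intro vanishes_below_mult_left vanishes_below_mono[OF vanishes_below_D_pow]) auto
  qed simp
  have "fps_nth (op f (op g a)) d = (\<Sum>i\<le>d. \<Sum>j\<le>d. ?h i j)"
    by (simp only: op_nth[OF order_refl] in_eq)
  also have "\<dots> = (\<Sum>n\<le>d. \<Sum>i\<le>n. ?h i (n - i))"
    by (rule triangle_sum_nat[symmetric]) (rule h0)
  also have "\<dots> = (\<Sum>n\<le>d. fps_nth (rconst (fps_nth (f * g) n) * (D ^^ n) a) d)"
    unfolding h by (intro sum.cong) (simp_all add: fps_mult_nth[of f] rconst_sum sum_distrib_right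
        fps_sum_nth atLeast0AtMost del: fps_mult_left_const_nth)
  finally show "fps_nth (op (f * g) a) d = fps_nth (op f (op g a)) d"
    by (simp only: op_nth[OF order_refl])
qed

lemma op_power: "op (f ^ k) a = (op f ^^ k) a"
  by (induction k) (simp_all add: op_mult)

lemma vanishes_below_op:
  assumes "vanishes_below d a"
  shows "vanishes_below d (op f a)"
  unfolding vanishes_below_def op_nth[OF order_refl]
proof (intro allI impI sum.neutral ballI)
  fix i n assume "i < d"
  then show "fps_nth (rconst (fps_nth f n) * (D ^^ n) a) i = 0"
    by (intro vanishes_below_nth[OF vanishes_below_mult_left[OF vanishes_below_D_pow[OF assms]]]) simp
qed

end

section \<open>The time-one flow as a Taylor expansion\<close>

context vector_field
begin

text \<open>\<open>traj\<close> is the displacement \<open>X(s) = \<Sum>\<^sub>n s\<^sup>n D\<^bsup>n-1\<^esup> L / n!\<close> of the flow of \<open>L \<partial>\<close>; it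
  solves \<open>X' = D X + L\<close>, \<open>X(0) = 0\<close>.\<close>

definition traj :: "nov fps" where
  "traj = Abs_fps (\<lambda>n. if n = 0 then 0 else rconst (1 / fact n) * (D ^^ (n - 1)) L)"

lemma fact_Suc_rconst: "of_nat (Suc n) * (rconst (1 / fact (Suc n)) * a) = rconst (1 / fact n) * a"
  unfolding rconst_of_nat[symmetric] mult.assoc[symmetric] rconst_mult[symmetric]
  by simp

lemma traj_Suc: "fps_nth traj (Suc n) = rconst (1 / fact (Suc n)) * (D ^^ n) L"
  by (simp add: traj_def)

lemma traj_0: "fps_nth traj 0 = 0"
  by (simp add: traj_def)

lemma vanishing_traj: "vanishing (fps_nth traj)"
  unfolding vanishing_def
proof
  fix n
  show "vanishes_below n (fps_nth traj n)"
  proof (cases n)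
    case (Suc m)
    then show ?thesis
      using vanishes_below_D_pow[OF vanishes_L, of m] by (simp add: traj_Suc vanishes_below_mult_left)
  qed simp
qed

definition Dc :: "nov fps \<Rightarrow> nov fps" where
  "Dc F = Abs_fps (\<lambda>n. D (fps_nth F n))"

lemma Dc_mult: "Dc (F * G) = Dc F * G + F * Dc G"
  by (rule fps_ext) (simp add: Dc_def fps_mult_nth D_sum D_mult sum.distrib)

lemma D_one: "D 1 = 0"
  using D_mult[of 1 1] by simp

lemma Dc_power: "Dc (F ^ k) = of_nat k * F ^ (k - 1) * Dc F"
proof (induction k)
  case 0
  show ?case by (rule fps_ext) (simp add: Dc_def D_one)
next
  case (Suc k)
  then show ?case by (cases k) (simp_all add: Dc_mult algebra_simps)
qed

lemma deriv_traj: "fps_deriv traj = Dc traj + fps_const L"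
proof (rule fps_ext)
  fix n
  show "fps_nth (fps_deriv traj) n = fps_nth (Dc traj + fps_const L) n"
  proof (cases n)
    case 0
    then show ?thesis
      by (simp add: Dc_def traj_0 traj_Suc one_pCons[symmetric])
  next
    case (Suc m)
    then show ?thesis
      using fact_Suc_rconst[of "Suc m" "(D ^^ Suc m) L"]
      by (simp add: Dc_def traj_Suc D_const_mult del: of_nat_Suc fact_Suc)
  qed
qed

lemma deriv_traj_power:
  "of_nat (Suc n) * fps_nth (traj ^ k) (Suc n)
     = D (fps_nth (traj ^ k) n) + of_nat k * (L * fps_nth (traj ^ (k - 1)) n)"
proof -
  have "fps_deriv (traj ^ k) = of_nat k * traj ^ (k - 1) * fps_deriv traj"
    by (simp add: fps_deriv_power fps_of_nat algebra_simps)
  also have "\<dots> = Dc (traj ^ k) + fps_const (of_nat k * L) * traj ^ (k - 1)"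
    unfolding deriv_traj Dc_power by (simp add: algebra_simps flip: fps_of_nat)
  finally have "fps_nth (fps_deriv (traj ^ k)) n
      = fps_nth (Dc (traj ^ k) + fps_const (of_nat k * L) * traj ^ (k - 1)) n" by simp
  then show ?thesis
    by (simp add: Dc_def mult.assoc)
qed

lemma traj_power_nth_0: "n < k \<Longrightarrow> fps_nth (traj ^ k) n = 0"
  using startsby_zero_power_prefix[of traj k] traj_0 by auto

text \<open>The coefficient of \<open>s\<^sup>n\<close> in \<open>n! X(s)\<^sup>k / k!\<close> is the partial Bell polynomial in
  \<open>L, D L, D\<^sup>2 L, \<dots>\<close>; on both sides the next case is obtained by applying \<open>D\<close>.\<close>

lemma D_pow_expansion:
  "rconst (1 / fact n) * (D ^^ n) a =
     (\<Sum>k\<le>n. rconst (1 / fact k) * fps_nth (traj ^ k) n * (\<delta> ^^ k) a)"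
proof (induction n)
  case 0
  show ?case by (simp add: one_pCons[symmetric])
next
  case (Suc n)
  let ?c = "\<lambda>k. rconst (1 / fact k)" and ?B = "\<lambda>k. fps_nth (traj ^ k)"
  have "of_nat (Suc n) * (?c (Suc n) * (D ^^ Suc n) a) = D (?c n * (D ^^ n) a)"
    by (simp only: fact_Suc_rconst D_const_mult funpow.simps comp_apply)
  also have "\<dots> = (\<Sum>k\<le>n. ?c k * D (?B k n) * (\<delta> ^^ k) a)
      + (\<Sum>k\<le>n. ?c k * (L * ?B k n) * (\<delta> ^^ Suc k) a)"
    unfolding Suc D_sum mult.assoc D_const_mult D_mult
    by (simp add: D_def sum.distrib algebra_simps)
  also have "(\<Sum>k\<le>n. ?c k * D (?B k n) * (\<delta> ^^ k) a) = (\<Sum>k\<le>Suc n. ?c k * D (?B k n) * (\<delta> ^^ k) a)"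
    by (simp add: traj_power_nth_0 del: power_Suc)
  also have "(\<Sum>k\<le>n. ?c k * (L * ?B k n) * (\<delta> ^^ Suc k) a)
      = (\<Sum>k\<le>Suc n. ?c k * (of_nat k * (L * ?B (k - 1) n)) * (\<delta> ^^ k) a)"
  proof -
    have "?c k * b = ?c (Suc k) * (of_nat (Suc k) * b)" for k and b :: nov
      using fact_Suc_rconst[of k b] by (simp only: mult.left_commute)
    then have "?c k * (L * ?B k n) * (\<delta> ^^ Suc k) a
        = ?c (Suc k) * (of_nat (Suc k) * (L * ?B k n)) * (\<delta> ^^ Suc k) a" for k
      by (simp only:)
    then show ?thesis
      by (simp only: sum.atMost_Suc_shift diff_Suc_1 of_nat_0 mult_zero_left mult_zero_right add_0)
  qed
  finally have "of_nat (Suc n) * (?c (Suc n) * (D ^^ Suc n) a)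
      = (\<Sum>k\<le>Suc n. ?c k * (D (?B k n) + of_nat k * (L * ?B (k - 1) n)) * (\<delta> ^^ k) a)"
    by (simp only: sum.distrib[symmetric] distrib_left distrib_right)
  also have "\<dots> = of_nat (Suc n) * (\<Sum>k\<le>Suc n. ?c k * ?B k (Suc n) * (\<delta> ^^ k) a)"
    unfolding deriv_traj_power[symmetric] sum_distrib_left
    by (rule sum.cong) (simp_all only: mult.assoc mult.left_commute)
  finally show ?case by (rule rconst_cancel)
qed

text \<open>\<open>X(1)\<close>\<close>

definition endpoint :: nov where
  "endpoint = fps_total (fps_nth traj)"

lemma op_exp_nth:
  "fps_nth (op (fps_exp 1) a) d = (\<Sum>k\<le>d. fps_nth (rconst (1 / fact k) * endpoint ^ k * (\<delta> ^^ k) a) d)"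
proof -
  let ?h = "\<lambda>k n. fps_nth (rconst (1 / fact k) * fps_nth (traj ^ k) n * (\<delta> ^^ k) a) d"
  have "fps_nth (rconst (1 / fact k) * endpoint ^ k * (\<delta> ^^ k) a) d = (\<Sum>n\<le>d. ?h k n)" for k
  proof -
    have v: "vanishing (fps_nth (traj ^ k))" by (rule vanishing_power[OF vanishing_traj])
    show ?thesis
      using fps_total_mult_left_nth[OF v order_refl, of "rconst (1 / fact k) * (\<delta> ^^ k) a" d]
      unfolding endpoint_def fps_total_power[OF vanishing_traj, symmetric] by (simp only: ac_simps)
  qed
  then have "(\<Sum>k\<le>d. fps_nth (rconst (1 / fact k) * endpoint ^ k * (\<delta> ^^ k) a) d) = (\<Sum>k\<le>d. \<Sum>n\<le>d. ?h k n)"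
    by simp
  also have "\<dots> = (\<Sum>n\<le>d. \<Sum>k\<le>d. ?h k n)" by (rule sum.swap)
  also have "\<dots> = (\<Sum>n\<le>d. \<Sum>k\<le>n. ?h k n)"
    by (rule sum.cong[OF refl], rule sum.mono_neutral_right) (auto simp: traj_power_nth_0)
  also have "\<dots> = fps_nth (op (fps_exp 1) a) d"
    unfolding op_nth[OF order_refl] fps_exp_def fps_nth_Abs_fps power_one of_nat_fact D_pow_expansion
      fps_sum_nth ..
  finally show ?thesis by simp
qed

end

section \<open>The exponential and its inverse\<close>

lemma nov_power_eq:
  assumes "fps_nth L 0 = 0"
  shows "nov_power (nov_scale c L) n = const (c ^ Suc n) * (vector_field.D L ^^ n) L"
proof -
  interpret vector_field L by standard (rule assms)
  show ?thesis
  proof (induction n)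
    case 0
    show ?case by (simp add: nov_scale_eq)
  next
    case (Suc n)
    have "nov_power (nov_scale c L) (Suc n) = \<delta> (const (c ^ Suc n) * (D ^^ n) L) * (const c * L)"
      using Suc by (simp add: nov_prod_eq nov_scale_eq)
    also have "\<dots> = const (c ^ Suc n) * const c * (L * \<delta> ((D ^^ n) L))"
      unfolding fps_nov_deriv_const_mult by (simp only: ac_simps)
    also have "const (c ^ Suc n) * const c = const (c ^ Suc (Suc n))"
      by (simp only: const_mult[symmetric] power_Suc2)
    also have "L * \<delta> ((D ^^ n) L) = (D ^^ Suc n) L" by (simp add: D_def)
    finally show ?case .
  qed
qed

lemma nov_exp_scale:
  assumes "fps_nth L 0 = 0"
  shows "vanishing (\<lambda>n. const (smult (1 / fact (Suc n)) (c ^ Suc n)) * (vector_field.D L ^^ n) L)"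
    and "nov_exp (nov_scale c L)
      = fps_total (\<lambda>n. const (smult (1 / fact (Suc n)) (c ^ Suc n)) * (vector_field.D L ^^ n) L)"
proof -
  interpret vector_field L by standard (rule assms)
  show 1: "vanishing (\<lambda>n. const (smult (1 / fact (Suc n)) (c ^ Suc n)) * (D ^^ n) L)"
    by (rule vanishing_op)
  have "nov_scale [:1 / fact (Suc n):] (nov_power (nov_scale c L) n)
      = const (smult (1 / fact (Suc n)) (c ^ Suc n)) * (D ^^ n) L" for n
    unfolding nov_power_eq[OF assms]
    unfolding nov_scale_eq mult.assoc[symmetric] const_mult[symmetric] by simp
  then show "nov_exp (nov_scale c L)
      = fps_total (\<lambda>n. const (smult (1 / fact (Suc n)) (c ^ Suc n)) * (D ^^ n) L)"
    unfolding nov_exp_def by (simp only: suminf_eq_fps_total[OF 1])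
qed

lemma (in vector_field) nov_exp_fps_total:
  "nov_exp L = fps_total (\<lambda>n. rconst (1 / fact (Suc n)) * (D ^^ n) L)"
proof -
  have "nov_scale 1 L = L" by (simp add: nov_scale_eq)
  then show ?thesis
    using nov_exp_scale(2)[OF L0, of 1] by (simp add: smult_one del: fact_Suc)
qed

lemma (in vector_field) endpoint_eq: "endpoint = nov_exp L"
proof (rule fps_ext)
  fix d
  have "fps_nth endpoint d = (\<Sum>n\<le>Suc d. fps_nth (fps_nth traj n) d)"
    unfolding endpoint_def by (rule fps_total_nth[OF vanishing_traj]) simp
  then show "fps_nth endpoint d = fps_nth (nov_exp L) d"
    unfolding sum.atMost_Suc_shift
    by (simp add: nov_exp_fps_total fps_total_def traj_0 traj_Suc del: fact_Suc)
qed

text \<open>The coefficient of index \<open>d\<close> is already reached after \<open>d + 1\<close> iterations from \<open>0\<close>.\<close>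

lemma contraction_fixed_point:
  fixes f :: "'a::zero fps \<Rightarrow> 'a fps"
  assumes S0: "0 \<in> S" and fS: "\<And>F. F \<in> S \<Longrightarrow> f F \<in> S"
    and closed: "\<And>F. (\<And>d. \<exists>G\<in>S. fps_nth F d = fps_nth G d) \<Longrightarrow> F \<in> S"
    and contr: "\<And>F G d. \<lbrakk>F \<in> S; G \<in> S; \<And>i. i < d \<Longrightarrow> fps_nth F i = fps_nth G i\<rbrakk>
      \<Longrightarrow> fps_nth (f F) d = fps_nth (f G) d"
  obtains F where "F \<in> S" "f F = F"
proof
  define F where "F = Abs_fps (\<lambda>d. fps_nth ((f ^^ Suc d) 0) d)"
  have it: "(f ^^ n) 0 \<in> S" for n
    by (induction n) (simp_all add: S0 fS)
  show FS: "F \<in> S"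
    by (rule closed) (use it F_def in \<open>auto intro!: bexI[of _ "(f ^^ Suc _) 0"] simp del: funpow.simps\<close>)
  have step: "i < n \<Longrightarrow> fps_nth ((f ^^ n) 0) i = fps_nth ((f ^^ Suc n) 0) i" for n i
  proof (induction n arbitrary: i)
    case (Suc n)
    have "fps_nth (f ((f ^^ n) 0)) i = fps_nth (f ((f ^^ Suc n) 0)) i"
      by (rule contr) (use it Suc in \<open>auto simp del: funpow.simps\<close>)
    then show ?case by simp
  qed simp
  have stable: "fps_nth ((f ^^ n) 0) i = fps_nth F i" if "i < n" for n i
    using that
  proof (induction n)
    case (Suc n)
    then show ?case
      using step[of i n] by (cases "i = n") (auto simp: F_def)
  qed simp
  show "f F = F"
  proof (rule fps_ext)
    fix d
    have "fps_nth (f F) d = fps_nth (f ((f ^^ d) 0)) d"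
      by (rule contr) (simp_all add: FS it stable)
    then show "fps_nth (f F) d = fps_nth F d" by (simp add: F_def)
  qed
qed

lemma monom_degree_superset:
  "finite S \<Longrightarrow> Poly_Mapping.keys m \<subseteq> S \<Longrightarrow> monom_degree m = (\<Sum>j\<in>S. Poly_Mapping.lookup m j)"
  unfolding monom_degree_def by (rule sum.mono_neutral_left) (auto simp: in_keys_iff)

lemma monom_weight_superset:
  "finite S \<Longrightarrow> Poly_Mapping.keys m \<subseteq> S
    \<Longrightarrow> monom_weight m = (\<Sum>j\<in>S. (int j - 1) * int (Poly_Mapping.lookup m j))"
  unfolding monom_weight_def by (rule sum.mono_neutral_left) (auto simp: in_keys_iff)

lemma monom_degree_add: "monom_degree (m + n) = monom_degree m + monom_degree n"
proof -
  let ?S = "Poly_Mapping.keys m \<union> Poly_Mapping.keys n"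
  show ?thesis
    using monom_degree_superset[of ?S m] monom_degree_superset[of ?S n]
      monom_degree_superset[of ?S "m + n"] Poly_Mapping.keys_add[of m n]
    by (simp add: lookup_add sum.distrib)
qed

lemma monom_weight_add: "monom_weight (m + n) = monom_weight m + monom_weight n"
proof -
  let ?S = "Poly_Mapping.keys m \<union> Poly_Mapping.keys n"
  show ?thesis
    using monom_weight_superset[of ?S m] monom_weight_superset[of ?S n]
      monom_weight_superset[of ?S "m + n"] Poly_Mapping.keys_add[of m n]
    by (simp add: lookup_add sum.distrib distrib_left)
qed

lemma monom_degree_single: "monom_degree (Poly_Mapping.single j n) = n"
  by (simp add: monom_degree_def)

lemma monom_weight_single: "monom_weight (Poly_Mapping.single j n) = (int j - 1) * int n"
  by (simp add: monom_weight_def)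

definition homogeneous :: "nat \<Rightarrow> int \<Rightarrow> 'c::comm_ring_1 dpoly set" where
  "homogeneous d w = {a. \<forall>m\<in>Poly_Mapping.keys a. monom_degree m = d \<and> monom_weight m = w}"

lemma homogeneous_0 [simp]: "0 \<in> homogeneous d w"
  by (simp add: homogeneous_def)

lemma homogeneous_add: "a \<in> homogeneous d w \<Longrightarrow> b \<in> homogeneous d w \<Longrightarrow> a + b \<in> homogeneous d w"
  using Poly_Mapping.keys_add[of a b] by (auto simp: homogeneous_def)

lemma homogeneous_uminus: "a \<in> homogeneous d w \<Longrightarrow> - a \<in> homogeneous d w"
  by (simp add: homogeneous_def)

lemma homogeneous_sum: "(\<And>i. i \<in> I \<Longrightarrow> f i \<in> homogeneous d w) \<Longrightarrow> sum f I \<in> homogeneous d w"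
  by (induction I rule: infinite_finite_induct) (simp_all add: homogeneous_add)

lemma homogeneous_mult:
  assumes "a \<in> homogeneous d w" "b \<in> homogeneous e v"
  shows "a * b \<in> homogeneous (d + e) (w + v)"
  unfolding homogeneous_def
proof (intro CollectI ballI)
  fix m assume "m \<in> Poly_Mapping.keys (a * b)"
  then obtain l q where "m = l + q" "l \<in> Poly_Mapping.keys a" "q \<in> Poly_Mapping.keys b"
    using keys_mult[of a b] by blast
  then show "monom_degree m = d + e \<and> monom_weight m = w + v"
    using assms by (simp add: homogeneous_def monom_degree_add monom_weight_add)
qed

lemma homogeneous_single: "Poly_Mapping.single m c \<in> homogeneous (monom_degree m) (monom_weight m)"
  by (simp add: homogeneous_def)

lemma homogeneous_scale: "a \<in> homogeneous d w \<Longrightarrow> scale c a \<in> homogeneous d w"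
  using homogeneous_mult[OF homogeneous_single[of 0 c], of a d w]
  by (simp add: scale_def monom_degree_def monom_weight_def)

lemma homogeneous_monom_deriv:
  "monom_deriv m \<in> homogeneous (monom_degree m) (monom_weight m + 1)"
  unfolding monom_deriv_def
proof (rule homogeneous_sum)
  fix j assume "j \<in> Poly_Mapping.keys m"
  let ?e = "\<lambda>j. Poly_Mapping.single j (1 :: nat)"
  have m: "m = (m - ?e j) + ?e j"
    using \<open>j \<in> _\<close> by (intro poly_mapping_eqI) (auto simp: lookup_add lookup_minus lookup_single when_def in_keys_iff)
  have "monom_degree (m - ?e j + ?e (Suc j)) = monom_degree m"
    by (subst (2) m) (simp only: monom_degree_add monom_degree_single)
  moreover have "monom_weight (m - ?e j + ?e (Suc j)) = monom_weight m + 1"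
    by (subst (2) m) (simp add: monom_weight_add monom_weight_single)
  ultimately show "Poly_Mapping.single (m - ?e j + ?e (Suc j)) (of_nat (Poly_Mapping.lookup m j))
      \<in> homogeneous (monom_degree m) (monom_weight m + 1)"
    using homogeneous_single[of "m - ?e j + ?e (Suc j)"] by simp
qed

lemma homogeneous_nov_deriv: "a \<in> homogeneous d w \<Longrightarrow> nov_deriv a \<in> homogeneous d (w + 1)"
  unfolding nov_deriv_def
proof (intro homogeneous_sum homogeneous_scale)
  fix m assume "a \<in> homogeneous d w" "m \<in> Poly_Mapping.keys a"
  then show "monom_deriv m \<in> homogeneous d (w + 1)"
    using homogeneous_monom_deriv[of m] by (auto simp: homogeneous_def)
qed

lemma nov_carrier_iff: "F \<in> nov_carrier \<longleftrightarrow> (\<forall>d. fps_nth F d \<in> homogeneous d (- 1))"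
  by (auto simp: nov_carrier_def homogeneous_def)

lemma nov_carrier_nth_0:
  assumes "F \<in> nov_carrier"
  shows "fps_nth F 0 = 0"
proof -
  have "False" if m: "m \<in> Poly_Mapping.keys (fps_nth F 0)" for m
  proof -
    have "monom_degree m = 0" "monom_weight m = - 1"
      using assms m by (auto simp: nov_carrier_def)
    moreover from this(1) have "m = 0"
      by (intro poly_mapping_eqI) (auto simp: monom_degree_def in_keys_iff)
    ultimately show False by (simp add: monom_weight_def)
  qed
  then show ?thesis by (metis ex_in_conv keys_eq_empty)
qed

lemma nov_prod_carrier:
  assumes "F \<in> nov_carrier" "G \<in> nov_carrier"
  shows "F \<triangleleft> G \<in> nov_carrier"
  unfolding nov_carrier_iff nov_prod_eq fps_mult_nth
proof (intro allI homogeneous_sum)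
  fix d i :: nat assume "i \<in> {0..d}"
  have "nov_deriv (fps_nth F i) * fps_nth G (d - i) \<in> homogeneous (i + (d - i)) (- 1 + 1 + - 1)"
    using assms unfolding nov_carrier_iff by (intro homogeneous_mult homogeneous_nov_deriv) auto
  then show "fps_nth (\<delta> F) i * fps_nth G (d - i) \<in> homogeneous d (- 1)"
    using \<open>i \<in> _\<close> by simp
qed

lemma nov_power_carrier: "F \<in> nov_carrier \<Longrightarrow> nov_power F n \<in> nov_carrier"
  by (induction n) (simp_all add: nov_prod_carrier)

lemma nov_exp_eq:
  assumes "F \<in> nov_carrier"
  shows "vanishing (\<lambda>n. nov_scale [:1 / fact (Suc n):] (nov_power F n))"
    and "nov_exp F = fps_total (\<lambda>n. nov_scale [:1 / fact (Suc n):] (nov_power F n))"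
proof -
  note F0 = nov_carrier_nth_0[OF assms]
  interpret vector_field F by standard (rule F0)
  have "nov_scale 1 F = F" by (simp add: nov_scale_eq)
  then have "nov_power F n = (D ^^ n) F" for n
    using nov_power_eq[OF F0, of 1 n] by simp
  then show 1: "vanishing (\<lambda>n. nov_scale [:1 / fact (Suc n):] (nov_power F n))"
    using vanishing_op[of "\<lambda>n. [:1 / fact (Suc n):]" F] by (simp add: nov_scale_eq del: fact_Suc)
  show "nov_exp F = fps_total (\<lambda>n. nov_scale [:1 / fact (Suc n):] (nov_power F n))"
    unfolding nov_exp_def by (rule suminf_eq_fps_total[OF 1])
qed

lemma nov_exp_carrier:
  assumes "F \<in> nov_carrier"
  shows "nov_exp F \<in> nov_carrier"
  unfolding nov_exp_eq(2)[OF assms] nov_carrier_iff fps_total_def fps_nth_Abs_fps nov_scale_def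
  using nov_power_carrier[OF assms] unfolding nov_carrier_iff
  by (intro allI homogeneous_sum homogeneous_scale) blast

lemma nov_power_agree:
  assumes "F \<in> nov_carrier" "G \<in> nov_carrier"
    and "\<And>i. i < d \<Longrightarrow> fps_nth F i = fps_nth G i" "i < d \<or> i = d \<and> n > 0"
  shows "fps_nth (nov_power F n) i = fps_nth (nov_power G n) i"
  using assms(4)
proof (induction n arbitrary: i)
  case 0
  then show ?case using assms(3) by simp
next
  case (Suc n)
  note F0 = nov_carrier_nth_0[OF assms(1)] nov_carrier_nth_0[OF assms(2)]
    nov_carrier_nth_0[OF nov_power_carrier[OF assms(1)]] nov_carrier_nth_0[OF nov_power_carrier[OF assms(2)]]
  have "nov_deriv (fps_nth (nov_power F n) j) * fps_nth F (i - j)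
      = nov_deriv (fps_nth (nov_power G n) j) * fps_nth G (i - j)" if "j \<le> i" for j
  proof (cases "j = 0 \<or> j = i")
    case True
    then show ?thesis by (auto simp: F0)
  next
    case False
    then have "j < d" "i - j < d" using that Suc.prems by auto
    then show ?thesis using Suc.IH[of j] assms(3)[of "i - j"] by simp
  qed
  then show ?case
    by (simp add: nov_prod_eq fps_mult_nth)
qed

lemma nov_exp_minus_agree:
  assumes "F \<in> nov_carrier" "G \<in> nov_carrier"
    and "\<And>i. i < d \<Longrightarrow> fps_nth F i = fps_nth G i"
  shows "fps_nth (nov_exp F - F) d = fps_nth (nov_exp G - G) d"
proof -
  have "fps_nth (nov_exp H - H) d
      = (\<Sum>n<d. scale [:1 / fact (Suc (Suc n)):] (fps_nth (nov_power H (Suc n)) d))" 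
    if H: "H \<in> nov_carrier" for H
    unfolding nov_exp_eq(2)[OF H] fps_sub_nth fps_total_def fps_nth_Abs_fps sum.atMost_shift
    by (simp add: nov_scale_def scale_def one_pCons[symmetric] del: nov_power.simps(2))
  then show ?thesis
    using nov_power_agree[OF assms] assms(1,2) by (simp del: nov_power.simps(2))
qed

lemma nov_gen_carrier: "nov_gen \<in> nov_carrier"
  unfolding nov_carrier_def
proof (intro CollectI allI ballI)
  fix d m assume "m \<in> Poly_Mapping.keys (fps_nth nov_gen d)"
  then have "d = 1" "m = Poly_Mapping.single 0 1"
    by (simp_all add: nov_gen_def nvar_def split: if_splits)
  then show "monom_degree m = d \<and> monom_weight m = - 1"
    by (simp add: monom_degree_single monom_weight_single)
qed

lemma nov_exp_surj:
  assumes "G \<in> nov_carrier"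
  obtains F where "F \<in> nov_carrier" "nov_exp F = G"
proof -
  let ?f = "\<lambda>F. G - (nov_exp F - F)"
  have "\<exists>F\<in>nov_carrier. ?f F = F"
  proof (rule contraction_fixed_point[of nov_carrier ?f])
    fix F assume F: "F \<in> nov_carrier"
    have "fps_nth G d + (- fps_nth (nov_exp F) d + fps_nth F d) \<in> homogeneous d (- 1)" for d
      using F assms nov_exp_carrier[OF F] unfolding nov_carrier_iff
      by (intro homogeneous_add homogeneous_uminus) auto
    then show "?f F \<in> nov_carrier" by (simp add: nov_carrier_iff algebra_simps)
  next
    fix F G' d assume "F \<in> nov_carrier" "G' \<in> nov_carrier" "\<And>i. i < d \<Longrightarrow> fps_nth F i = fps_nth G' i"
    from nov_exp_minus_agree[OF this] show "fps_nth (?f F) d = fps_nth (?f G') d"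
      unfolding fps_sub_nth[of G] by simp
  next
    fix F :: nov assume "\<And>d. \<exists>G\<in>nov_carrier. fps_nth F d = fps_nth G d"
    then show "F \<in> nov_carrier" by (metis nov_carrier_iff)
  qed (auto simp: nov_carrier_iff)
  then obtain F where "F \<in> nov_carrier" "?f F = F" by blast
  then show thesis by (intro that[of F]) (simp_all add: diff_eq_eq)
qed

lemma nov_log_nov_gen:
  "nov_log nov_gen \<in> nov_carrier" "nov_exp (nov_log nov_gen) = nov_gen"
proof -
  have "nov_gen \<in> nov_exp ` nov_carrier"
    using nov_exp_surj[OF nov_gen_carrier] by (metis imageI)
  then show "nov_log nov_gen \<in> nov_carrier" "nov_exp (nov_log nov_gen) = nov_gen"
    unfolding nov_log_def by (simp_all only: inv_into_into f_inv_into_f)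
qed

section \<open>Compositions and iterated Taylor operators\<close>

lemma finite_compositions: "finite (compositions i n)"
proof (rule finite_subset)
  show "compositions i n \<subseteq> {ks. set ks \<subseteq> {..n} \<and> length ks = i}"
    by (auto simp: compositions_def member_le_sum_list)
qed (simp add: finite_lists_length_eq)

lemma compositions_0: "compositions 0 n = (if n = 0 then {[]} else {})"
  by (auto simp: compositions_def)

lemma compositions_Suc:
  "compositions (Suc i) n = (\<lambda>(k, ks). ks @ [k]) ` (SIGMA k:{1..n}. compositions i (n - k))"
proof (intro set_eqI iffI)
  fix ks assume "ks \<in> compositions (Suc i) n"
  moreover from this obtain ls k where "ks = ls @ [k]"
    by (cases ks rule: rev_cases) (auto simp: compositions_def)
  ultimately show "ks \<in> (\<lambda>(k, ks). ks @ [k]) ` (SIGMA k:{1..n}. compositions i (n - k))"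
    by (intro image_eqI[of _ _ "(k, ls)"]) (auto simp: compositions_def)
qed (auto simp: compositions_def)

lemma brace_replicate: "brace y (replicate k z) = z ^ k * (nov_deriv ^^ k) y"
  by (simp add: brace_def prod_list_replicate)

lemma nov_deriv_pow_sum: "(nov_deriv ^^ k) (sum f I) = (\<Sum>i\<in>I. (nov_deriv ^^ k) (f i))"
  by (induction k) (simp_all add: nov_deriv_sum)

lemma nov_deriv_pow_scale: "(nov_deriv ^^ k) (scale c a) = scale c ((nov_deriv ^^ k) a)"
  by (induction k) (simp_all add: nov_deriv_scale)

definition brace_sum :: "nat \<Rightarrow> nat \<Rightarrow> rat dpoly" where
  "brace_sum i n = (\<Sum>ks\<in>compositions i n. scale (1 / (\<Prod>k\<leftarrow>ks. fact k)) (nested_brace ks))"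

lemma brace_sum_0: "brace_sum 0 n = (if n = 0 then nvar 0 else 0)"
  by (simp add: brace_sum_def compositions_0 nested_brace_def scale_def)

lemma brace_sum_Suc:
  "brace_sum (Suc i) n
     = (\<Sum>k=1..n. scale (1 / fact k) (nvar 0 ^ k * (nov_deriv ^^ k) (brace_sum i (n - k))))"
proof -
  let ?g = "\<lambda>ks. scale (1 / (\<Prod>k\<leftarrow>ks. fact k)) (nested_brace ks)"
  have g: "?g (ks @ [k]) = scale (1 / fact k) (nvar 0 ^ k * (nov_deriv ^^ k) (?g ks))" for ks k
  proof -
    have "Poly_Mapping.single 0 (1 / ((\<Prod>k\<leftarrow>ks. fact k) * fact k))
        = Poly_Mapping.single 0 (1 / fact k) * Poly_Mapping.single (0 :: monomial) (1 / (\<Prod>k\<leftarrow>ks. fact k) :: rat)"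
      by (simp add: mult_single mult.commute)
    then show ?thesis
      unfolding nov_deriv_pow_scale
      by (simp add: nested_brace_def brace_replicate scale_def ac_simps)
  qed
  have "inj_on (\<lambda>(k, ks). ks @ [k :: nat]) A" for A by (auto simp: inj_on_def)
  then have "brace_sum (Suc i) n = (\<Sum>(k, ks)\<in>(SIGMA k:{1..n}. compositions i (n - k)). ?g (ks @ [k]))"
    unfolding brace_sum_def compositions_Suc by (subst sum.reindex) (auto intro: sum.cong)
  also have "\<dots> = (\<Sum>k=1..n. \<Sum>ks\<in>compositions i (n - k). ?g (ks @ [k]))"
    by (subst sum.Sigma) (auto simp: finite_compositions)
  also have "\<dots> = (\<Sum>k=1..n. \<Sum>ks\<in>compositions i (n - k).
      scale (1 / fact k) (nvar 0 ^ k * (nov_deriv ^^ k) (?g ks)))"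
    by (simp only: g)
  finally show ?thesis
    by (simp add: brace_sum_def nov_deriv_pow_sum sum_distrib_left scale_def)
qed

lemma n_coeff_Suc:
  assumes "is_partition p"
  shows "n_coeff p (Suc i) = part_coeff p (brace_sum i (sum_list p))"
proof (cases i)
  case 0
  show ?thesis
  proof (cases p)
    case Nil
    then show ?thesis
      by (simp add: 0 brace_sum_0 part_coeff_def part_fact_def part_exponent_def nvar_def)
  next
    case (Cons a q)
    then have "sum_list p \<noteq> 0" using assms by (simp add: is_partition_def)
    then show ?thesis
      using Cons unfolding 0 brace_sum_0 by (simp only: n_coeff.simps) (simp add: part_coeff_def)
  qed
next
  case (Suc j)
  then show ?thesis by (simp add: brace_sum_def)
qed

section \<open>Extension of scalars\<close>

definition ext_scalars :: "rat dpoly \<Rightarrow> rat poly dpoly" where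
  "ext_scalars = Poly_Mapping.map (\<lambda>c. [:c:])"

lemma lookup_ext_scalars: "Poly_Mapping.lookup (ext_scalars a) m = [:Poly_Mapping.lookup a m:]"
  by (simp add: ext_scalars_def map.rep_eq when_def)

lemma ext_scalars_single: "ext_scalars (Poly_Mapping.single m c) = Poly_Mapping.single m [:c:]"
  by (rule poly_mapping_eqI) (simp add: lookup_ext_scalars lookup_single when_def)

lemma ext_scalars_add: "ext_scalars (a + b) = ext_scalars a + ext_scalars b"
  by (rule poly_mapping_eqI) (simp add: lookup_ext_scalars lookup_add)

lemma ext_scalars_0 [simp]: "ext_scalars 0 = 0"
  by (rule poly_mapping_eqI) (simp add: lookup_ext_scalars)

lemma ext_scalars_sum: "ext_scalars (sum f I) = (\<Sum>i\<in>I. ext_scalars (f i))"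
  by (induction I rule: infinite_finite_induct) (simp_all add: ext_scalars_add)

lemma ext_scalars_nvar: "ext_scalars (nvar j) = nvar j"
  by (simp add: nvar_def ext_scalars_single one_pCons[symmetric])

lemma dpoly_induct:
  assumes "P 0" "\<And>m c. P (Poly_Mapping.single m c)" "\<And>a b. P a \<Longrightarrow> P b \<Longrightarrow> P (a + b)"
  shows "P (a :: 'c::comm_ring_1 dpoly)"
proof -
  have "P (\<Sum>m\<in>M. Poly_Mapping.single m (Poly_Mapping.lookup a m))" for M
    by (induction M rule: infinite_finite_induct) (simp_all add: assms)
  then show ?thesis by (subst dpoly_as_sum)
qed

lemma ext_scalars_mult: "ext_scalars (a * b) = ext_scalars a * ext_scalars b"
proof (induction a rule: dpoly_induct)
  case (2 m c)
  show ?case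
  proof (induction b rule: dpoly_induct)
    case (2 n d)
    show ?case by (simp add: ext_scalars_single mult_single mult.commute)
  qed (simp_all add: ext_scalars_add distrib_left)
qed (simp_all add: ext_scalars_add distrib_right)

lemma ext_scalars_power: "ext_scalars (a ^ k) = ext_scalars a ^ k"
proof (induction k)
  case 0
  show ?case using ext_scalars_single[of 0 1] by (simp add: one_pCons[symmetric])
qed (simp add: ext_scalars_mult)

lemma ext_scalars_scale: "ext_scalars (scale c a) = scale [:c:] (ext_scalars a)"
  by (simp add: scale_def ext_scalars_mult ext_scalars_single)

lemma ext_scalars_nov_deriv: "ext_scalars (nov_deriv a) = nov_deriv (ext_scalars a)"
proof (induction a rule: dpoly_induct)
  case (2 m c)
  have "ext_scalars (monom_deriv m) = monom_deriv m"
    by (simp add: monom_deriv_def ext_scalars_sum ext_scalars_single of_nat_poly)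
  then show ?case
    by (simp add: nov_deriv_single ext_scalars_scale ext_scalars_single)
qed (simp_all add: ext_scalars_add nov_deriv_add)

lemma ext_scalars_nov_deriv_pow: "ext_scalars ((nov_deriv ^^ k) a) = (nov_deriv ^^ k) (ext_scalars a)"
  by (induction k) (simp_all add: ext_scalars_nov_deriv)

lemma part_coeff_ext_scalars: "part_coeff p (ext_scalars a) = [:part_coeff p a:]"
  by (simp add: part_coeff_def lookup_ext_scalars of_nat_poly)

section \<open>The flow\<close>

lemma fps_nov_deriv_pow_nth: "fps_nth ((\<delta> ^^ k) a) d = (nov_deriv ^^ k) (fps_nth a d)"
  by (induction k) simp_all

lemma nov_gen_eq: "nov_gen = fps_const (nvar 0) * fps_X"
  by (rule fps_ext) (simp add: nov_gen_def)

lemma nov_gen_power: "nov_gen ^ k = fps_const (nvar 0 ^ k) * fps_X ^ k"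
  unfolding nov_gen_eq power_mult_distrib by simp

context vector_field
begin

lemma op_exp_minus_1_nth:
  assumes "endpoint = nov_gen"
  shows "fps_nth (op (fps_exp 1 - 1) a) d
    = (\<Sum>k=1..d. scale [:1 / fact k:] (nvar 0 ^ k * (nov_deriv ^^ k) (fps_nth a (d - k))))"
proof -
  have t: "fps_nth (rconst (1 / fact k) * nov_gen ^ k * (\<delta> ^^ k) a) d
      = scale [:1 / fact k:] (nvar 0 ^ k * (nov_deriv ^^ k) (fps_nth a (d - k)))" if "k \<le> d" for k
    using that unfolding nov_gen_power mult.assoc
    by (simp add: fps_X_power_mult_nth fps_nov_deriv_pow_nth scale_def)
  have "{..d} = insert 0 {1..d}" by auto
  then have "fps_nth (op (fps_exp 1) a) d = fps_nth a d
      + (\<Sum>k=1..d. fps_nth (rconst (1 / fact k) * nov_gen ^ k * (\<delta> ^^ k) a) d)"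
    unfolding op_exp_nth assms by (simp add: one_pCons[symmetric])
  then show ?thesis
    unfolding op_diff by (simp add: t del: fps_mult_left_const_nth)
qed

lemma op_exp_minus_1_pow_nth:
  assumes "endpoint = nov_gen"
  shows "fps_nth ((op (fps_exp 1 - 1) ^^ i) nov_gen) (Suc n) = ext_scalars (brace_sum i n)"
proof (induction i arbitrary: n)
  case 0
  show ?case by (simp add: nov_gen_def brace_sum_0 ext_scalars_nvar)
next
  case (Suc i)
  have low: "vanishes_below 1 ((op (fps_exp 1 - 1) ^^ i) nov_gen)"
    by (induction i) (simp_all add: vanishes_below_op, simp add: vanishes_below_def nov_gen_def)
  have "fps_nth ((op (fps_exp 1 - 1) ^^ i) nov_gen) 0 = 0"
    using low by (simp add: vanishes_below_def)
  then have 0: "(nov_deriv ^^ Suc n) (fps_nth ((op (fps_exp 1 - 1) ^^ i) nov_gen) 0) = 0"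
    using nov_deriv_pow_sum[of "Suc n" "\<lambda>_. 0" "{}"] by simp
  have "fps_nth ((op (fps_exp 1 - 1) ^^ Suc i) nov_gen) (Suc n)
      = (\<Sum>k=1..n. scale [:1 / fact k:] (nvar 0 ^ k *
          (nov_deriv ^^ k) (fps_nth ((op (fps_exp 1 - 1) ^^ i) nov_gen) (Suc n - k))))"
    using 0 by (simp add: op_exp_minus_1_nth[OF assms] scale_def)
  also have "\<dots> = ext_scalars (brace_sum (Suc i) n)"
    unfolding brace_sum_Suc ext_scalars_sum ext_scalars_scale ext_scalars_mult ext_scalars_power
      ext_scalars_nvar ext_scalars_nov_deriv_pow Suc[symmetric]
    by (rule sum.cong) (simp_all add: Suc_diff_le)
  finally show ?case .
qed

end

lemma power_binom_poly_expansion: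
  assumes "n \<le> N"
  shows "smult (1 / fact n) ([:0, 1:] ^ n)
    = (\<Sum>k\<le>N. smult (fps_nth ((fps_exp 1 - 1) ^ k) n) (binom_poly k))" (is "?p = ?q")
proof (rule ccontr)
  let ?u = "fps_exp 1 - 1 :: rat fps"
  assume "?p \<noteq> ?q"
  then have "finite {x. poly (?p - ?q) x = 0}" by (intro poly_roots_finite) simp
  moreover have "poly (?p - ?q) (of_nat m) = 0" for m
  proof -
    have u0: "fps_nth (?u ^ k) n = 0" if "n < k" for k
      using startsby_zero_power_prefix[of ?u k] that by auto
    have "fps_exp (of_nat m) = (\<Sum>k\<le>m. of_nat (m choose k) * ?u ^ k)"
      using binomial_ring[of ?u 1 m] by (simp add: fps_exp_power_mult)
    then have "fps_nth (fps_exp (of_nat m)) n = fps_nth (\<Sum>k\<le>m. of_nat (m choose k) * ?u ^ k) n"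
      by simp
    then have "of_nat m ^ n / fact n = (\<Sum>k\<le>m. of_nat (m choose k) * fps_nth (?u ^ k) n)"
      by (simp add: fps_sum_nth flip: fps_of_nat)
    also have "\<dots> = (\<Sum>k\<le>max m N. of_nat (m choose k) * fps_nth (?u ^ k) n)"
      by (rule sum.mono_neutral_left) auto
    also have "\<dots> = (\<Sum>k\<le>N. of_nat (m choose k) * fps_nth (?u ^ k) n)"
      by (rule sum.mono_neutral_right) (use assms u0 in auto)
    finally show ?thesis
      by (simp add: poly_sum poly_binom_poly binomial_gbinomial mult.commute)
  qed
  then have "range of_nat \<subseteq> {x. poly (?p - ?q) x = 0}" by auto
  moreover have "infinite (range (of_nat :: nat \<Rightarrow> rat))" by (intro range_inj_infinite inj_of_nat)
  ultimately show False using finite_subset by blast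
qed

lemma nov_flow_nth:
  "fps_nth nov_flow (Suc N) = (\<Sum>k=1..Suc N. scale (binom_poly k) (ext_scalars (brace_sum (k - 1) N)))"
proof -
  define L where "L = nov_log nov_gen"
  have L: "L \<in> nov_carrier" "nov_exp L = nov_gen" using nov_log_nov_gen by (simp_all add: L_def)
  note L0 = nov_carrier_nth_0[OF L(1)]
  interpret vector_field L by standard (rule L0)
  have e: "endpoint = nov_gen" by (simp add: endpoint_eq L)
  define u where "u = (fps_exp 1 - 1 :: rat fps)"
  define v where "v = fps_shift 1 u"
  have u: "u = fps_X * v" by (rule fps_ext) (simp add: v_def u_def)
  have uk: "fps_nth (u ^ Suc k) (Suc n) = fps_nth (u ^ k * v) n" for k n
  proof -
    have "u ^ Suc k = fps_X * (u ^ k * v)" by (subst power_Suc, subst u) (simp only: ac_simps)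
    then show ?thesis by (simp del: power_Suc)
  qed
  have opv: "op v L = nov_gen"
    using L(2) unfolding nov_exp_fps_total op_def v_def u_def by (simp del: fact_Suc)
  have last: "fps_nth (const c * (D ^^ Suc N) L) (Suc N) = 0" for c
    by (rule vanishes_below_nth[OF vanishes_below_mult_left[OF vanishes_below_D_pow[OF vanishes_L]]]) simp
  have coef: "const (smult (1 / fact (Suc n)) ([:0, 1:] ^ Suc n))
      = (\<Sum>k\<le>N. const (binom_poly (Suc k)) * rconst (fps_nth (u ^ k * v) n))" if "n \<le> N" for n
  proof -
    have "smult (1 / fact (Suc n)) ([:0, 1:] ^ Suc n)
        = (\<Sum>k\<le>N. binom_poly (Suc k) * [:fps_nth (u ^ k * v) n:])"
      using power_binom_poly_expansion[of "Suc n" "Suc N"] that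
      unfolding sum.atMost_Suc_shift u_def[symmetric] uk by simp
    then show ?thesis by (simp only: const_sum const_mult)
  qed
  have "fps_nth nov_flow (Suc N)
      = (\<Sum>n\<le>Suc N. fps_nth (const (smult (1 / fact (Suc n)) ([:0, 1:] ^ Suc n)) * (D ^^ n) L) (Suc N))"
    unfolding nov_flow_def L_def[symmetric] nov_exp_scale(2)[OF L0]
    by (rule fps_total_nth[OF nov_exp_scale(1)[OF L0] order_refl])
  also have "\<dots> = (\<Sum>n\<le>N. \<Sum>k\<le>N.
      fps_nth (const (binom_poly (Suc k)) * (rconst (fps_nth (u ^ k * v) n) * (D ^^ n) L)) (Suc N))"
    unfolding sum.atMost_Suc last add_0_right
    by (rule sum.cong[OF refl]) (simp only: coef atMost_iff sum_distrib_right fps_sum_nth mult.assoc)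
  also have "\<dots> = (\<Sum>k\<le>N. scale (binom_poly (Suc k))
      (\<Sum>n\<le>N. fps_nth (rconst (fps_nth (u ^ k * v) n) * (D ^^ n) L) (Suc N)))"
    by (subst sum.swap) (simp add: scale_def sum_distrib_left)
  also have "\<dots> = (\<Sum>k\<le>N. scale (binom_poly (Suc k)) (fps_nth (op (u ^ k * v) L) (Suc N)))"
    unfolding op_nth[OF order_refl] sum.atMost_Suc last add_0_right ..
  also have "\<dots> = (\<Sum>k\<le>N. scale (binom_poly (Suc k)) (ext_scalars (brace_sum k N)))"
    unfolding op_mult opv op_power u_def op_exp_minus_1_pow_nth[OF e] ..
  also have "\<dots> = (\<Sum>k=1..Suc N. scale (binom_poly k) (ext_scalars (brace_sum (k - 1) N)))"
    by (rule sum.reindex_bij_witness[of _ "\<lambda>k. k - 1" Suc]) auto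
  finally show ?thesis .
qed

lemma part_coeff_sum: "part_coeff p (sum f I) = (\<Sum>i\<in>I. part_coeff p (f i))"
  by (simp add: part_coeff_def lookup_sum sum_distrib_left)

lemma part_coeff_scale: "part_coeff p (scale c a) = c * part_coeff p a"
proof -
  have "Poly_Mapping.lookup (scale c a) m = c * Poly_Mapping.lookup a m" for m
    unfolding scale_def mult_map_scale_conv_mult[symmetric] by (simp add: map.rep_eq when_def)
  then show ?thesis by (simp add: part_coeff_def)
qed

theorem proposition9p1:
  fixes p :: "nat list"
  assumes "is_partition p"
  shows "Q_coeff p = (\<Sum>k=1..sum_list p + 1. smult (n_coeff p k) (binom_poly k))"
proof -
  have "Q_coeff p = (\<Sum>k=1..Suc (sum_list p). binom_poly k * [:part_coeff p (brace_sum (k - 1) (sum_list p)):])"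
    by (simp add: Q_coeff_def nov_flow_nth part_coeff_sum part_coeff_scale part_coeff_ext_scalars
        del: sum.cl_ivl_Suc)
  also have "\<dots> = (\<Sum>k=1..Suc (sum_list p). smult (n_coeff p k) (binom_poly k))"
  proof (rule sum.cong[OF refl])
    fix k assume "k \<in> {1..Suc (sum_list p)}"
    then obtain i where "k = Suc i" by (cases k) auto
    then show "binom_poly k * [:part_coeff p (brace_sum (k - 1) (sum_list p)):]
        = smult (n_coeff p k) (binom_poly k)"
      by (simp add: n_coeff_Suc[OF assms] del: n_coeff.simps)
  qed
  finally show ?thesis by simp
qed

end
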